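(* Assume that the only stationary solutions of the homogeneous system $U_t+F(U)_x=0$ are the constant ones, and that the reconstruction operator satisfies, for all $\mathcal G_{-r},\dots,\mathcal G_{s}\in\mathbb R^N$ and all $V\in\mathbb R^N$, $$\mathcal R(\mathcal G_{-r}-V,\dots,\mathcal G_{s}-V)=\mathcal R(\mathcal G_{-r},\dots,\mathcal G_{s})-V .$$ Then the well-balanced methods described in the context reduce to conservative schemes when $H$ is locally constant. More precisely, let $U_i^*$ be the stationary solution of $U_t+F(U)_x=S(U)H_x$, defined in the interval $[x_{i-r-1},x_{i+s}]$, used by the method at node $i$. If $H$ is constant in $[x_{i-r-1},x_{i+s}]$, then $U_i^*$ is also constant there, $$\widehat{\mathcal F}_{i,i+1/2}=\widehat F_{i+1/2}-F(U_i^* ),\qquad \widehat{\mathcal F}_{i,i-1/2}=\widehat F_{i-1/2}-F(U_i^* ),$$ where $$\widehat F_{i+1/2}=\mathcal R(F(U_{i-r}),\dots,F(U_{i+s})),\qquad \widehat F_{i-1/2}=\mathcal R(F(U_{i-r-1}),\dots,F(U_{i+s-1})),$$ and thus the equation of the method for $U_i$ reduces to that of the conservative scheme $$\frac{dU_i}{dt}+\frac{1}{\Delta x}\left(\widehat F_{i+1/2}-\widehat F_{i-1/2}\right)=0 .$$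
   Context: Setting. $\Omega\subset\mathbb R^N$, $F,S:\Omega\to\mathbb R^N$ are smooth, $H:\mathbb R\to\mathbb R$ is continuous and a.e. differentiable. A stationary solution of $U_t+F(U)_x=S(U)H_x$ on an interval is a (locally absolutely continuous) $\Omega$-valued function $U^*$ with $\frac{d}{dx}F(U^*(x))=S(U^*(x))H_x(x)$ for almost every $x$ in the interval; a stationary solution of the homogeneous system is defined likewise with right-hand side $0$. Mesh. Uniform nodes $x_j$ with step $\Delta x$. Fix integers $r,s\ge0$ and a reconstruction operator $\mathcal R:(\mathbb R^N)^{r+s+1}\to\mathbb R^N$. The methods. Given values $U_j\in\Omega$, each method selects for each $i$ a stationary solution $U_i^*$ and sets $\mathcal F_j=F(U_j)-F(U_i^*(x_j))$, $j=i-1-r,\dots,i+s$, and $$\widehat{\mathcal F}_{i,i+1/2}=\mathcal R(\mathcal F_{i-r},\dots,\mathcal F_{i+s}),\qquad \widehat{\mathcal F}_{i,i-1/2}=\mathcal R(\mathcal F_{i-1-r},\dots,\mathcal F_{i-1+s}).$$ (a) Method preserving every stationary solution: $U_i^*$ is the stationary solution with $U_i^*(x_i)=U_i$, and the scheme is $\frac{dU_i}{dt}+\frac1{\Delta x}(\widehat{\mathcal F}_{i,i+1/2}-\widehat{\mathcal F}_{i,i-1/2})=0$. (b) Methods preserving a prescribed family of stationary solutions: $U_i^*$ is a member of the family (selected by matching a fixed set of components of $U_i$ at $x_i$; or, if the family has a single element $U^*$, $U_i^*=U^*$ for all $i$), and the scheme is $\frac{dU_i}{dt}+\frac1{\Delta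 x}(\widehat{\mathcal F}_{i,i+1/2}-\widehat{\mathcal F}_{i,i-1/2})=(S(U_i)-S(U_i^*(x_i)))H_x(x_i)$, where $H_x(x_i)$ is the derivative of $H$ at the node $x_i$. *)

theory Defs
  imports "HOL-Analysis.Analysis"
begin

section \<open>Smoothness and absolute continuity\<close>

text \<open>On an open set: all iterated directional derivatives up to order \<open>n\<close> exist and are
  continuous, i.e. the function is of class \<open>C\<^sup>n\<close>.\<close>

fun higher_differentiable_on ::
  "'a::euclidean_space set \<Rightarrow> ('a \<Rightarrow> 'b::real_normed_vector) \<Rightarrow> nat \<Rightarrow> bool" where
  "higher_differentiable_on W f 0 \<longleftrightarrow> continuous_on W f"
| "higher_differentiable_on W f (Suc n) \<longleftrightarrow>
     (\<forall>x\<in>W. f differentiable (at x)) \<and>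
     (\<forall>v. higher_differentiable_on W (\<lambda>x. frechet_derivative f (at x) v) n)"

text \<open>The domain need not be open: smoothness on an arbitrary set means that the function
  extends, near each point of the set, to a \<open>C\<^sup>\<infinity>\<close> function on an open
  neighbourhood. On an open set this is the usual notion.\<close>

definition smooth_on ::
  "'a::euclidean_space set \<Rightarrow> ('a \<Rightarrow> 'b::real_normed_vector) \<Rightarrow> bool" where
  "smooth_on A f \<longleftrightarrow>
     (\<forall>p\<in>A. \<exists>W g. open W \<and> p \<in> W \<and> (\<forall>n. higher_differentiable_on W g n) \<and>
        (\<forall>x \<in> A \<inter> W. g x = f x))"

definition abs_continuous_on_interval ::
  "real \<Rightarrow> real \<Rightarrow> (real \<Rightarrow> 'a::real_normed_vector) \<Rightarrow> bool" where
  "abs_continuous_on_interval a b f \<longleftrightarrow>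
     (\<forall>\<epsilon>>0. \<exists>\<delta>>0. \<forall>(n::nat) (l::nat \<Rightarrow> real) (u::nat \<Rightarrow> real).
        (\<forall>k<n. a \<le> l k \<and> l k \<le> u k \<and> u k \<le> b) \<and>
        (\<forall>j<n. \<forall>k<n. j \<noteq> k \<longrightarrow> {l j<..<u j} \<inter> {l k<..<u k} = {}) \<and>
        (\<Sum>k<n. u k - l k) < \<delta>
        \<longrightarrow> (\<Sum>k<n. norm (f (u k) - f (l k))) < \<epsilon>)"

definition locally_abs_continuous_on ::
  "real set \<Rightarrow> (real \<Rightarrow> 'a::real_normed_vector) \<Rightarrow> bool" where
  "locally_abs_continuous_on I f \<longleftrightarrow>
     (\<forall>a b. {a..b} \<subseteq> I \<longrightarrow> abs_continuous_on_interval a b f)"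

section \<open>Stationary solutions\<close>

text \<open>Stationary solutions of \<open>U\<^sub>t + F(U)\<^sub>x = G(x, U)\<close> on the interval \<open>I\<close>. Functions of \<open>x\<close> are
  total in HOL; only their values on \<open>I\<close> matter.\<close>

definition stationary_solution ::
  "(real^'n) set \<Rightarrow> (real^'n \<Rightarrow> real^'n) \<Rightarrow> (real \<Rightarrow> real^'n \<Rightarrow> real^'n) \<Rightarrow>
   real set \<Rightarrow> (real \<Rightarrow> real^'n) \<Rightarrow> bool" where
  "stationary_solution \<Omega> F G I V \<longleftrightarrow>
     is_interval I \<and> V ` I \<subseteq> \<Omega> \<and> locally_abs_continuous_on I V \<and>
     (AE x in lebesgue. x \<in> I \<longrightarrow>
        ((\<lambda>y. F (V y)) has_vector_derivative G x (V x)) (at x within I))"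

text \<open>\<open>S(U) H\<^sub>x\<close>; the value of \<open>deriv H\<close> where \<open>H\<close> is not differentiable is
  irrelevant for stationary solutions, since \<open>H\<close> is assumed differentiable almost everywhere.\<close>

definition balance_source ::
  "(real^'n \<Rightarrow> real^'n) \<Rightarrow> (real \<Rightarrow> real) \<Rightarrow> real \<Rightarrow> real^'n \<Rightarrow> real^'n" where
  "balance_source S H x u = deriv H x *\<^sub>R S u"

section \<open>Mesh, reconstruction and methods\<close>

definition node :: "real \<Rightarrow> real \<Rightarrow> int \<Rightarrow> real" where
  "node x0 dx j = x0 + of_int j * dx"

definition stencil :: "real \<Rightarrow> real \<Rightarrow> nat \<Rightarrow> nat \<Rightarrow> int \<Rightarrow> real set" where
  "stencil x0 dx r s i = {node x0 dx (i - int r - 1)..node x0 dx (i + int s)}"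

text \<open>A reconstruction operator \<open>(\<real>\<^sup>N)\<^sup>r\<^sup>+\<^sup>s\<^sup>+\<^sup>1 \<rightarrow> \<real>\<^sup>N\<close> is represented by a function on lists, which
  is only ever applied to lists of length \<open>r + s + 1\<close>. The following is
  \<open>R(G\<^sub>i\<^sub>-\<^sub>r, \<dots>, G\<^sub>i\<^sub>+\<^sub>s)\<close>, the reconstruction at the intercell \<open>i + 1/2\<close>; the one
  at \<open>i - 1/2\<close> is obtained at index \<open>i - 1\<close>.\<close>

definition reconstruct ::
  "((real^'n) list \<Rightarrow> real^'n) \<Rightarrow> nat \<Rightarrow> nat \<Rightarrow> (int \<Rightarrow> real^'n) \<Rightarrow> int \<Rightarrow> real^'n" where
  "reconstruct R r s G i = R (map G [i - int r..i + int s])"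

definition translation_equivariant ::
  "((real^'n) list \<Rightarrow> real^'n) \<Rightarrow> nat \<Rightarrow> nat \<Rightarrow> bool" where
  "translation_equivariant R r s \<longleftrightarrow>
     (\<forall>Gs V. length Gs = r + s + 1 \<longrightarrow> R (map (\<lambda>G. G - V) Gs) = R Gs - V)"

text \<open>\<open>F(U\<^sub>j) - F(V(x\<^sub>j))\<close>, where \<open>V\<close> is the stationary solution used at the current node.\<close>

definition flux_fluctuation ::
  "(real^'n \<Rightarrow> real^'n) \<Rightarrow> real \<Rightarrow> real \<Rightarrow> (int \<Rightarrow> real^'n) \<Rightarrow> (real \<Rightarrow> real^'n) \<Rightarrow>
   int \<Rightarrow> real^'n" where
  "flux_fluctuation F x0 dx u V j = F (u j) - F (V (node x0 dx j))"

text \<open>Choice of the stationary solution \<open>V\<close> at node \<open>i\<close>, given the nodal values \<open>u\<close>: first for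
  the method that preserves every stationary solution, then for a method that preserves a
  prescribed family. The elements of a family are pairs of an interval and a stationary solution
  on it; \<open>K\<close> is the set of components that are matched at \<open>x\<^sub>i\<close>. No matching is required for
  a family with a single element.\<close>

definition selects_general ::
  "(real^'n) set \<Rightarrow> (real^'n \<Rightarrow> real^'n) \<Rightarrow> (real^'n \<Rightarrow> real^'n) \<Rightarrow> (real \<Rightarrow> real) \<Rightarrow>
   real \<Rightarrow> real \<Rightarrow> nat \<Rightarrow> nat \<Rightarrow>
   (int \<Rightarrow> real^'n) \<Rightarrow> int \<Rightarrow> (real \<Rightarrow> real^'n) \<Rightarrow> bool" where
  "selects_general \<Omega> F S H x0 dx r s u i V \<longleftrightarrow>
     stationary_solution \<Omega> F (balance_source S H) (stencil x0 dx r s i) V \<and>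
     V (node x0 dx i) = u i"

definition stationary_family ::
  "(real^'n) set \<Rightarrow> (real^'n \<Rightarrow> real^'n) \<Rightarrow> (real^'n \<Rightarrow> real^'n) \<Rightarrow> (real \<Rightarrow> real) \<Rightarrow>
   (real set \<times> (real \<Rightarrow> real^'n)) set \<Rightarrow> bool" where
  "stationary_family \<Omega> F S H Fam \<longleftrightarrow>
     (\<forall>(J, V) \<in> Fam. stationary_solution \<Omega> F (balance_source S H) J V)"

definition selects_family ::
  "(real set \<times> (real \<Rightarrow> real^'n)) set \<Rightarrow> 'n set \<Rightarrow> real \<Rightarrow> real \<Rightarrow> nat \<Rightarrow> nat \<Rightarrow>
   (int \<Rightarrow> real^'n) \<Rightarrow> int \<Rightarrow> (real \<Rightarrow> real^'n) \<Rightarrow> bool" where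
  "selects_family Fam K x0 dx r s u i V \<longleftrightarrow>
     (\<exists>J. (J, V) \<in> Fam \<and> stencil x0 dx r s i \<subseteq> J \<and>
        (Fam = {(J, V)} \<or> (\<forall>k\<in>K. V (node x0 dx i) $ k = u i $ k)))"

text \<open>\<open>dw/dt + (f\<^sub>R - f\<^sub>L)/\<Delta>x = q\<close> at time \<open>t\<close> of the time interval \<open>T\<close> (one-sided
  derivative at an end point of \<open>T\<close>).\<close>

definition semidiscrete_eq ::
  "real \<Rightarrow> real set \<Rightarrow> real \<Rightarrow> (real \<Rightarrow> real^'n) \<Rightarrow> real^'n \<Rightarrow> real^'n \<Rightarrow> real^'n \<Rightarrow> bool" where
  "semidiscrete_eq dx T t w fR fL q \<longleftrightarrow>
     (\<exists>D. (w has_vector_derivative D) (at t within T) \<and> D + (1 / dx) *\<^sub>R (fR - fL) = q)"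

end

theory Submission
  imports Defs
begin

text \<open>Where H is constant, the source S(U) H_x vanishes almost everywhere, so the stationary
  solution used at node i solves the homogeneous system on the stencil
  (\<open>stationary_solution_homogeneous\<close>) and is constant there by assumption, with value
  c. All fluctuations entering the two reconstructions are then F(U_j) - F(c) with the same shift
  F(c), which equivariance pulls out of the reconstruction
  (\<open>reconstruct_flux_fluctuation\<close>). The shift cancels in the difference of the two
  fluxes, leaving the conservative difference. For the family methods the right-hand side also
  vanishes, because its factor H_x(x_i) is 0.\<close>

text \<open>The end points are included although H may vary outside the interval: a two-sided
  derivative agrees with the derivative within the interval, which is 0 and is unique because a < b
  makes every point of the interval a limit point of it.\<close>

lemma deriv_eq_0_if_constant_on_Icc:
  fixes H :: "real \<Rightarrow> real"
  assumes "H constant_on {a..b}" "a < b" "x \<in> {a..b}" "H differentiable (at x)"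
  shows "deriv H x = 0"
proof -
  obtain k where k: "\<And>y. y \<in> {a..b} \<Longrightarrow> H y = k"
    using assms(1) unfolding constant_on_def by blast
  have "(H has_field_derivative deriv H x) (at x)"
    using assms(4) DERIV_deriv_iff_real_differentiable by blast
  then have 1: "(H has_vector_derivative deriv H x) (at x within {a..b})"
    using has_field_derivative_at_within has_real_derivative_iff_has_vector_derivative by blast
  have 2: "(H has_vector_derivative 0) (at x within {a..b})"
    using assms(3) k has_vector_derivative_const by (rule has_vector_derivative_transform)
  have "at x within {a..b} \<noteq> bot"
    using assms(2,3) by (simp add: trivial_limit_within islimpt_Icc)
  from vector_derivative_unique_within[OF this 1 2] show ?thesis .
qed

text \<open>Members of a family live on their own interval J, which may be larger than the stencil;
  this brings them down to the stencil.\<close>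

lemma stationary_solution_subset:
  assumes "stationary_solution \<Omega> F G J V" "I \<subseteq> J" "is_interval I"
  shows "stationary_solution \<Omega> F G I V"
proof -
  have "AE x in lebesgue. x \<in> J \<longrightarrow>
      ((\<lambda>y. F (V y)) has_vector_derivative G x (V x)) (at x within J)"
    using assms(1) by (simp add: stationary_solution_def)
  then have "AE x in lebesgue. x \<in> I \<longrightarrow>
      ((\<lambda>y. F (V y)) has_vector_derivative G x (V x)) (at x within I)"
    by (rule AE_mp) (use assms(2) in \<open>auto intro: has_vector_derivative_within_subset\<close>)
  moreover have "locally_abs_continuous_on I V" "V ` I \<subseteq> \<Omega>"
    using assms(1,2) by (auto simp: stationary_solution_def locally_abs_continuous_on_def)
  ultimately show ?thesis
    using assms(3) by (simp add: stationary_solution_def)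
qed

lemma stationary_solution_homogeneous:
  assumes "stationary_solution \<Omega> F (balance_source S H) {a..b} V"
    and "AE x in lebesgue. H differentiable (at x)"
    and "H constant_on {a..b}" "a < b"
  shows "stationary_solution \<Omega> F (\<lambda>_ _. 0) {a..b} V"
proof -
  have "AE x in lebesgue. x \<in> {a..b} \<longrightarrow>
      ((\<lambda>y. F (V y)) has_vector_derivative balance_source S H x (V x)) (at x within {a..b})"
    using assms(1) by (simp add: stationary_solution_def)
  with assms(2) have "AE x in lebesgue. x \<in> {a..b} \<longrightarrow>
      ((\<lambda>y. F (V y)) has_vector_derivative 0) (at x within {a..b})"
  \<comment> \<open>Only points where H is differentiable survive here, so \<open>deriv H x\<close>
    is a genuine derivative and not an arbitrary value.\<close>
  proof eventually_elim
    case (elim x)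
    then show ?case
      using deriv_eq_0_if_constant_on_Icc[OF assms(3,4), of x] by (auto simp: balance_source_def)
  qed
  then show ?thesis
    using assms(1) by (simp add: stationary_solution_def)
qed

lemma node_mono: "dx > 0 \<Longrightarrow> j \<le> k \<Longrightarrow> node x0 dx j \<le> node x0 dx k"
  by (simp add: node_def mult_right_mono)

lemma node_strict_mono: "dx > 0 \<Longrightarrow> j < k \<Longrightarrow> node x0 dx j < node x0 dx k"
  by (simp add: node_def)

lemma node_in_stencil:
  "dx > 0 \<Longrightarrow> i - int r - 1 \<le> j \<Longrightarrow> j \<le> i + int s \<Longrightarrow> node x0 dx j \<in> stencil x0 dx r s i"
  by (simp add: stencil_def node_mono)

text \<open>The centre k is kept free so that k = i and k = i - 1 give the right and left intercell
  fluxes of the same node i, with the same c.\<close>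

lemma reconstruct_flux_fluctuation:
  assumes "translation_equivariant R r s"
    and "\<And>j. k - int r \<le> j \<Longrightarrow> j \<le> k + int s \<Longrightarrow> V (node x0 dx j) = c"
  shows "reconstruct R r s (flux_fluctuation F x0 dx u V) k =
    reconstruct R r s (\<lambda>j. F (u j)) k - F c"
proof -
  have "map (flux_fluctuation F x0 dx u V) [k - int r..k + int s] =
      map (\<lambda>G. G - F c) (map (\<lambda>j. F (u j)) [k - int r..k + int s])"
    using assms(2) by (simp add: flux_fluctuation_def)
  moreover have "length (map (\<lambda>j. F (u j)) [k - int r..k + int s]) = r + s + 1"
    by simp
  ultimately show ?thesis
    using assms(1) unfolding reconstruct_def translation_equivariant_def by metis
qed

theorem mainTheorem4:
  fixes \<Omega> :: "(real^'n) set"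
    and F S :: "real^'n \<Rightarrow> real^'n"
    and H :: "real \<Rightarrow> real"
    and x0 dx :: real and r s :: nat
    and R :: "(real^'n) list \<Rightarrow> real^'n"
    and Fam :: "(real set \<times> (real \<Rightarrow> real^'n)) set" and K :: "'n set"
    and T :: "real set" and t :: real and i :: int
    and U :: "real \<Rightarrow> int \<Rightarrow> real^'n"
    and Ustar :: "real \<Rightarrow> int \<Rightarrow> real \<Rightarrow> real^'n"
  defines "FF \<equiv> flux_fluctuation F x0 dx (U t) (Ustar t i)"
    and "Fhat \<equiv> reconstruct R r s (\<lambda>j. F (U t j))"
  assumes "smooth_on \<Omega> F" and "smooth_on \<Omega> S"
    and "continuous_on UNIV H" and "AE x in lebesgue. H differentiable (at x)"
    and "dx > 0"
    and "is_interval T" and "t \<in> T" and "\<And>\<tau> j. \<tau> \<in> T \<Longrightarrow> U \<tau> j \<in> \<Omega>"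
    and homogeneous_constant:
      "\<And>J V. stationary_solution \<Omega> F (\<lambda>_ _. 0) J V \<Longrightarrow> V constant_on J"
    and "translation_equivariant R r s"
    and "stationary_family \<Omega> F S H Fam"
    and "selects_general \<Omega> F S H x0 dx r s (U t) i (Ustar t i) \<or>
         selects_family Fam K x0 dx r s (U t) i (Ustar t i)"
    and "H constant_on stencil x0 dx r s i"
  shows
    "(\<exists>c. (\<forall>x \<in> stencil x0 dx r s i. Ustar t i x = c) \<and>
        reconstruct R r s FF i = Fhat i - F c \<and>
        reconstruct R r s FF (i - 1) = Fhat (i - 1) - F c) \<and>
     (selects_general \<Omega> F S H x0 dx r s (U t) i (Ustar t i) \<longrightarrow>
        (semidiscrete_eq dx T t (\<lambda>\<tau>. U \<tau> i)
            (reconstruct R r s FF i) (reconstruct R r s FF (i - 1)) 0 \<longleftrightarrow>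
         semidiscrete_eq dx T t (\<lambda>\<tau>. U \<tau> i) (Fhat i) (Fhat (i - 1)) 0)) \<and>
     (selects_family Fam K x0 dx r s (U t) i (Ustar t i) \<and>
      H differentiable (at (node x0 dx i)) \<longrightarrow>
        (semidiscrete_eq dx T t (\<lambda>\<tau>. U \<tau> i)
            (reconstruct R r s FF i) (reconstruct R r s FF (i - 1))
            (deriv H (node x0 dx i) *\<^sub>R (S (U t i) - S (Ustar t i (node x0 dx i)))) \<longleftrightarrow>
         semidiscrete_eq dx T t (\<lambda>\<tau>. U \<tau> i) (Fhat i) (Fhat (i - 1)) 0))"
proof -
  let ?I = "stencil x0 dx r s i"
  let ?V = "Ustar t i"
  let ?a = "node x0 dx (i - int r - 1)" and ?b = "node x0 dx (i + int s)"
  \<comment> \<open>Strict even for r = s = 0, since the stencil always reaches back to node i -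
    1.\<close>
  have ab: "?a < ?b"
    using \<open>dx > 0\<close> by (intro node_strict_mono) auto
  have const: "H constant_on {?a..?b}"
    using \<open>H constant_on ?I\<close> by (simp add: stencil_def)
  have "stationary_solution \<Omega> F (balance_source S H) ?I ?V"
    using \<open>selects_general \<Omega> F S H x0 dx r s (U t) i ?V \<or> selects_family Fam K x0 dx r s (U t) i ?V\<close>
  proof
    assume "selects_general \<Omega> F S H x0 dx r s (U t) i ?V"
    then show ?thesis by (simp add: selects_general_def)
  next
    assume "selects_family Fam K x0 dx r s (U t) i ?V"
    then obtain J where J: "(J, ?V) \<in> Fam" "?I \<subseteq> J"
      by (auto simp: selects_family_def)
    from J(1) have "stationary_solution \<Omega> F (balance_source S H) J ?V"
      using \<open>stationary_family \<Omega> F S H Fam\<close> by (auto simp: stationary_family_def)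
    then show ?thesis
      using J(2) by (rule stationary_solution_subset) (simp add: stencil_def)
  qed
  then have "stationary_solution \<Omega> F (\<lambda>_ _. 0) ?I ?V"
    using \<open>AE x in lebesgue. H differentiable (at x)\<close> const ab
    unfolding stencil_def by (rule stationary_solution_homogeneous)
  then have "?V constant_on ?I"
    by (rule homogeneous_constant)
  then obtain c where c: "\<And>x. x \<in> ?I \<Longrightarrow> ?V x = c"
    unfolding constant_on_def by blast
  \<comment> \<open>The nodes used for k = i and k = i - 1 together run from i - r - 1 to i + s,
    exactly the range of the stencil on which \<open>?V\<close> equals c.\<close>
  have rec: "reconstruct R r s FF k = Fhat k - F c" if "k = i \<or> k = i - 1" for k
    unfolding FF_def Fhat_def using \<open>translation_equivariant R r s\<close>
    by (rule reconstruct_flux_fluctuation)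
      (use that \<open>dx > 0\<close> in \<open>auto intro!: c node_in_stencil\<close>)
  have diff: "reconstruct R r s FF i - reconstruct R r s FF (i - 1) = Fhat i - Fhat (i - 1)"
    by (simp add: rec)
  \<comment> \<open>Differentiability almost everywhere says nothing about one given node, so it is
    a separate premise here, matching the one in the family case of the conclusion.\<close>
  have "deriv H (node x0 dx i) = 0" if "H differentiable (at (node x0 dx i))"
    using const ab _ that
    by (rule deriv_eq_0_if_constant_on_Icc)
      (use node_in_stencil[OF \<open>dx > 0\<close>, of i r i s x0] in \<open>simp add: stencil_def\<close>)
  then show ?thesis
    using c rec by (auto simp: semidiscrete_eq_def diff)
qed

end
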